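(* Let $P:\mathbb C^{\mathrm{op}}\to\mathbf{Pos}$ be a doctrine and $X$ an object of $\mathbb C$. The 1-arrow $(F_X,\mathfrak f):P\to P_X$ and the $\mathbb C_X$-arrow $\mathrm{id}_X:\mathbf t_{\mathbb C_X}\rightsquigarrow X$ are universal: for every doctrine $R:\mathbb D^{\mathrm{op}}\to\mathbf{Pos}$, every 1-arrow $(G,\mathfrak g):P\to R$ and every $\mathbb D$-arrow $c:\mathbf t_{\mathbb D}\to G(X)$, there exists a 1-arrow $(G',\mathfrak g'):P_X\to R$, unique up to a unique natural isomorphism, such that $(G',\mathfrak g')\circ(F_X,\mathfrak f)=(G,\mathfrak g)$ and $G'(\mathrm{id}_X)=c$.
   Context: A doctrine is a functor $P:\mathbb C^{\mathrm{op}}\to\mathbf{Pos}$ with $\mathbb C$ a category with finite products and $\mathbf{Pos}$ the category of posets and monotone maps. A 1-arrow (doctrine homomorphism) from $P:\mathbb C^{\mathrm{op}}\to\mathbf{Pos}$ to $R:\mathbb D^{\mathrm{op}}\to\mathbf{Pos}$ is a pair $(F,\mathfrak f)$ with $F:\mathbb C\to\mathbb D$ a finite-product-preserving functor and $\mathfrak f:P\to R\circ F^{\mathrm{op}}$ natural. Composition: $(G,\mathfrak g)\circ(F,\mathfrak f)=(GF,(\mathfrak g_{FA}\mathfrak f_A)_A)$. A 2-cell $(F,\mathfrak f)\Rightarrow(G,\mathfrak g):P\to R$ is a natural transformation $\theta:F\to G$ with $\mathfrak f_A(\alpha)\le R(\theta_A)(\mathfrak g_A(\alpha))$ for all $A$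 and $\alpha\in P(A)$. The category $\mathbb C_X$ has the same objects as $\mathbb C$; an arrow $g:A\rightsquigarrow B$ in $\mathbb C_X$ is a $\mathbb C$-arrow $g:X\times A\to B$; the identity of $A$ is $\mathrm{pr}_2:X\times A\to A$; the composite of $g:A\rightsquigarrow B$ and $h:B\rightsquigarrow C$ is $h\langle\mathrm{pr}_1,g\rangle$. It has finite products, given on objects by those of $\mathbb C$. The doctrine $P_X:\mathbb C_X^{\mathrm{op}}\to\mathbf{Pos}$ has $P_X(A)=P(X\times A)$ and reindexing along $g:A\rightsquigarrow B$ given by $P(\langle\mathrm{pr}_1,g\rangle):P(X\times B)\to P(X\times A)$. The 1-arrow $(F_X,\mathfrak f):P\to P_X$: $F_X$ is the identity on objects and sends $f:A\to B$ to $f\,\mathrm{pr}_2:A\rightsquigarrow B$; $\mathfrak f_A(\alpha)=P(\mathrm{pr}_2)(\alpha)\in P(X\times A)$. Conventions: $\mathbf t$ denotes a terminal object. The arrow $\mathrm{id}_X:\mathbf t\rightsquigarrow X$ of $\mathbb C_X$ is the $\mathbb C$-arrow $\mathrm{pr}_1:X\times\mathbf t\to X$ ($X\times\mathbf t$ identified with $X$). The arrow $G'(\mathrm{id}_X)$ is regarded as having domain $\mathbf t_{\mathbb D}$ via the canonical isomorphism $G'(\mathbf t)\cong\mathbf t_{\mathbb D}$. "Unique up to a unique natural isomorphism" means: for any two such 1-arrows there is exactly one invertible 2-cell between them whose whiskering with $(F_X,\mathfrak f)$ is the identity. *)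

theory Defs
  imports "HOL-Algebra.Order"
begin

section \<open>Categories with finite products\<close>

text \<open>
  Arrows carry their domain and codomain. Finite products are given by a chosen terminal object
  and chosen binary product diagrams. Nothing is assumed about the values of the operations
  outside the carriers \<open>Obj\<close> and \<open>Arr\<close>.
\<close>

record ('o, 'a) fp_category =
  Obj :: "'o set"
  Arr :: "'a set"
  Dom :: "'a \<Rightarrow> 'o"
  Cod :: "'a \<Rightarrow> 'o"
  Id :: "'o \<Rightarrow> 'a"
  Comp :: "'a \<Rightarrow> 'a \<Rightarrow> 'a"  (infixr \<open>\<cdot>\<index>\<close> 70)
  Term :: 'o  (\<open>\<^bold>t\<index>\<close>)
  Prod :: "'o \<Rightarrow> 'o \<Rightarrow> 'o"
  Pr1 :: "'o \<Rightarrow> 'o \<Rightarrow> 'a"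
  Pr2 :: "'o \<Rightarrow> 'o \<Rightarrow> 'a"

definition hom :: "('o, 'a, 'm) fp_category_scheme \<Rightarrow> 'o \<Rightarrow> 'o \<Rightarrow> 'a set" where
  "hom C A B = {f \<in> Arr C. Dom C f = A \<and> Cod C f = B}"

definition is_terminal :: "('o, 'a, 'm) fp_category_scheme \<Rightarrow> 'o \<Rightarrow> bool" where
  "is_terminal C T \<longleftrightarrow> T \<in> Obj C \<and> (\<forall>Z\<in>Obj C. \<exists>!h. h \<in> hom C Z T)"

definition is_product ::
  "('o, 'a, 'm) fp_category_scheme \<Rightarrow> 'o \<Rightarrow> 'o \<Rightarrow> 'o \<Rightarrow> 'a \<Rightarrow> 'a \<Rightarrow> bool" where
  "is_product C A B Q p q \<longleftrightarrow>
     Q \<in> Obj C \<and> p \<in> hom C Q A \<and> q \<in> hom C Q B \<and>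
     (\<forall>Z\<in>Obj C. \<forall>f\<in>hom C Z A. \<forall>g\<in>hom C Z B.
        \<exists>!h. h \<in> hom C Z Q \<and> p \<cdot>\<^bsub>C\<^esub> h = f \<and> q \<cdot>\<^bsub>C\<^esub> h = g)"

locale fp_category =
  fixes C (structure)
  assumes Dom_Obj: "f \<in> Arr C \<Longrightarrow> Dom C f \<in> Obj C"
    and Cod_Obj: "f \<in> Arr C \<Longrightarrow> Cod C f \<in> Obj C"
    and Id_hom: "A \<in> Obj C \<Longrightarrow> Id C A \<in> hom C A A"
    and Comp_hom: "\<lbrakk>f \<in> hom C A B; g \<in> hom C B D\<rbrakk> \<Longrightarrow> g \<cdot> f \<in> hom C A D"
    and Comp_Id: "f \<in> hom C A B \<Longrightarrow> f \<cdot> Id C A = f"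
    and Id_Comp: "f \<in> hom C A B \<Longrightarrow> Id C B \<cdot> f = f"
    and Comp_assoc:
      "\<lbrakk>f \<in> hom C A B; g \<in> hom C B D; h \<in> hom C D E\<rbrakk> \<Longrightarrow> (h \<cdot> g) \<cdot> f = h \<cdot> (g \<cdot> f)"
    and Term_terminal: "is_terminal C \<^bold>t"
    and Prod_product:
      "\<lbrakk>A \<in> Obj C; B \<in> Obj C\<rbrakk> \<Longrightarrow> is_product C A B (Prod C A B) (Pr1 C A B) (Pr2 C A B)"

definition tuple :: "('o, 'a, 'm) fp_category_scheme \<Rightarrow> 'a \<Rightarrow> 'a \<Rightarrow> 'a" where
  "tuple C f g =
     (THE h. h \<in> hom C (Dom C f) (Prod C (Cod C f) (Cod C g)) \<and>
             Pr1 C (Cod C f) (Cod C g) \<cdot>\<^bsub>C\<^esub> h = f \<and>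
             Pr2 C (Cod C f) (Cod C g) \<cdot>\<^bsub>C\<^esub> h = g)"


section \<open>Doctrines\<close>

record ('o, 'a, 'p) doctrine = "('o, 'a) fp_category" +
  Fib :: "'o \<Rightarrow> 'p gorder"
  Reindex :: "'a \<Rightarrow> 'p \<Rightarrow> 'p"

locale doctrine = fp_category P for P (structure) +
  assumes Fib_poset: "A \<in> Obj P \<Longrightarrow> partial_order (Fib P A)"
    and Reindex_carrier:
      "f \<in> hom P A B \<Longrightarrow> Reindex P f \<in> carrier (Fib P B) \<rightarrow> carrier (Fib P A)"
    and Reindex_isotone:
      "f \<in> hom P A B \<Longrightarrow> isotone (Fib P B) (Fib P A) (Reindex P f)"
    and Reindex_Id:
      "\<lbrakk>A \<in> Obj P; \<alpha> \<in> carrier (Fib P A)\<rbrakk> \<Longrightarrow> Reindex P (Id P A) \<alpha> = \<alpha>"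
    and Reindex_Comp:
      "\<lbrakk>f \<in> hom P A B; g \<in> hom P B D; \<alpha> \<in> carrier (Fib P D)\<rbrakk>
        \<Longrightarrow> Reindex P (g \<cdot> f) \<alpha> = Reindex P f (Reindex P g \<alpha>)"


section \<open>1-arrows\<close>

text \<open>
  All components of 1-arrows and of 2-cells are extensional functions (equal to \<^const>\<open>undefined\<close>
  outside their domains), so that equality of 1-arrows and of 2-cells is equality in the logic.
\<close>

record ('o, 'a, 'p, 'd, 'b, 'q) one_arrow =
  on_obj :: "'o \<Rightarrow> 'd"
  on_arr :: "'a \<Rightarrow> 'b"
  on_fib :: "'o \<Rightarrow> 'p \<Rightarrow> 'q"

locale one_arrow =
  fixes P :: "('o, 'a, 'p) doctrine" and R :: "('d, 'b, 'q) doctrine"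
    and F :: "('o, 'a, 'p, 'd, 'b, 'q) one_arrow"
  assumes on_obj_Obj: "on_obj F \<in> Obj P \<rightarrow>\<^sub>E Obj R"
    and on_arr_ext: "on_arr F \<in> extensional (Arr P)"
    and on_arr_hom: "f \<in> hom P A B \<Longrightarrow> on_arr F f \<in> hom R (on_obj F A) (on_obj F B)"
    and on_arr_Id: "A \<in> Obj P \<Longrightarrow> on_arr F (Id P A) = Id R (on_obj F A)"
    and on_arr_Comp:
      "\<lbrakk>f \<in> hom P A B; g \<in> hom P B D\<rbrakk>
        \<Longrightarrow> on_arr F (g \<cdot>\<^bsub>P\<^esub> f) = on_arr F g \<cdot>\<^bsub>R\<^esub> on_arr F f"
    and preserves_terminal: "is_terminal P T \<Longrightarrow> is_terminal R (on_obj F T)"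
    and preserves_product:
      "\<lbrakk>A \<in> Obj P; B \<in> Obj P; is_product P A B Q p q\<rbrakk>
        \<Longrightarrow> is_product R (on_obj F A) (on_obj F B) (on_obj F Q) (on_arr F p) (on_arr F q)"
    and on_fib_ext: "on_fib F \<in> extensional (Obj P)"
    and on_fib_carrier:
      "A \<in> Obj P \<Longrightarrow> on_fib F A \<in> carrier (Fib P A) \<rightarrow>\<^sub>E carrier (Fib R (on_obj F A))"
    and on_fib_isotone:
      "A \<in> Obj P \<Longrightarrow> isotone (Fib P A) (Fib R (on_obj F A)) (on_fib F A)"
    and on_fib_natural:
      "\<lbrakk>f \<in> hom P A B; \<alpha> \<in> carrier (Fib P B)\<rbrakk>
        \<Longrightarrow> on_fib F A (Reindex P f \<alpha>) = Reindex R (on_arr F f) (on_fib F B \<alpha>)"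

definition one_comp ::
  "('o, 'a, 'p) doctrine \<Rightarrow> ('d, 'b, 'q, 'e, 'c, 'r) one_arrow \<Rightarrow> ('o, 'a, 'p, 'd, 'b, 'q) one_arrow
    \<Rightarrow> ('o, 'a, 'p, 'e, 'c, 'r) one_arrow" where
  "one_comp P G F =
     \<lparr>on_obj = \<lambda>A\<in>Obj P. on_obj G (on_obj F A),
      on_arr = \<lambda>f\<in>Arr P. on_arr G (on_arr F f),
      on_fib = \<lambda>A\<in>Obj P. \<lambda>\<alpha>\<in>carrier (Fib P A). on_fib G (on_obj F A) (on_fib F A \<alpha>)\<rparr>"


section \<open>2-cells\<close>

definition two_cell ::
  "('o, 'a, 'p) doctrine \<Rightarrow> ('d, 'b, 'q) doctrine \<Rightarrow> ('o, 'a, 'p, 'd, 'b, 'q) one_arrow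
    \<Rightarrow> ('o, 'a, 'p, 'd, 'b, 'q) one_arrow \<Rightarrow> ('o \<Rightarrow> 'b) \<Rightarrow> bool" where
  "two_cell P R F G \<theta> \<longleftrightarrow>
     \<theta> \<in> extensional (Obj P) \<and>
     (\<forall>A\<in>Obj P. \<theta> A \<in> hom R (on_obj F A) (on_obj G A)) \<and>
     (\<forall>A\<in>Obj P. \<forall>B\<in>Obj P. \<forall>f\<in>hom P A B.
        \<theta> B \<cdot>\<^bsub>R\<^esub> on_arr F f = on_arr G f \<cdot>\<^bsub>R\<^esub> \<theta> A) \<and>
     (\<forall>A\<in>Obj P. \<forall>\<alpha>\<in>carrier (Fib P A).
        on_fib F A \<alpha> \<sqsubseteq>\<^bsub>Fib R (on_obj F A)\<^esub> Reindex R (\<theta> A) (on_fib G A \<alpha>))"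

definition id_cell ::
  "('o, 'a, 'p) doctrine \<Rightarrow> ('d, 'b, 'q) doctrine \<Rightarrow> ('o, 'a, 'p, 'd, 'b, 'q) one_arrow
    \<Rightarrow> 'o \<Rightarrow> 'b" where
  "id_cell P R F = (\<lambda>A\<in>Obj P. Id R (on_obj F A))"

definition vcomp ::
  "('o, 'a, 'p) doctrine \<Rightarrow> ('d, 'b, 'q) doctrine \<Rightarrow> ('o \<Rightarrow> 'b) \<Rightarrow> ('o \<Rightarrow> 'b) \<Rightarrow> 'o \<Rightarrow> 'b" where
  "vcomp P R \<eta> \<theta> = (\<lambda>A\<in>Obj P. \<eta> A \<cdot>\<^bsub>R\<^esub> \<theta> A)"

definition whisker ::
  "('o, 'a, 'p) doctrine \<Rightarrow> ('d \<Rightarrow> 'c) \<Rightarrow> ('o, 'a, 'p, 'd, 'b, 'q) one_arrow \<Rightarrow> 'o \<Rightarrow> 'c" where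
  "whisker P \<theta> F = (\<lambda>A\<in>Obj P. \<theta> (on_obj F A))"

definition invertible_two_cell ::
  "('o, 'a, 'p) doctrine \<Rightarrow> ('d, 'b, 'q) doctrine \<Rightarrow> ('o, 'a, 'p, 'd, 'b, 'q) one_arrow
    \<Rightarrow> ('o, 'a, 'p, 'd, 'b, 'q) one_arrow \<Rightarrow> ('o \<Rightarrow> 'b) \<Rightarrow> bool" where
  "invertible_two_cell P R F G \<theta> \<longleftrightarrow>
     two_cell P R F G \<theta> \<and>
     (\<exists>\<eta>. two_cell P R G F \<eta> \<and>
          vcomp P R \<eta> \<theta> = id_cell P R F \<and> vcomp P R \<theta> \<eta> = id_cell P R G)"


section \<open>Adjoining a constant\<close>

text \<open>
  An arrow \<open>A \<leadsto> B\<close> of the new base category is an arrow \<open>g : X \<times> A \<rightarrow> B\<close> of the old one. It is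
  encoded as the pair \<open>(A, g)\<close>, since \<open>A\<close> need not be determined by the object \<open>X \<times> A\<close>.
\<close>

definition adjoin :: "('o, 'a, 'p) doctrine \<Rightarrow> 'o \<Rightarrow> ('o, 'o \<times> 'a, 'p) doctrine" where
  "adjoin P X =
     \<lparr>Obj = Obj P,
      Arr = {(A, g). A \<in> Obj P \<and> g \<in> Arr P \<and> Dom P g = Prod P X A},
      Dom = \<lambda>(A, g). A,
      Cod = \<lambda>(A, g). Cod P g,
      Id = \<lambda>A. (A, Pr2 P X A),
      Comp = \<lambda>(B, h) (A, g). (A, h \<cdot>\<^bsub>P\<^esub> tuple P (Pr1 P X A) g),
      Term = Term P,
      Prod = Prod P,
      Pr1 = \<lambda>A B. (Prod P A B, Pr1 P A B \<cdot>\<^bsub>P\<^esub> Pr2 P X (Prod P A B)),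
      Pr2 = \<lambda>A B. (Prod P A B, Pr2 P A B \<cdot>\<^bsub>P\<^esub> Pr2 P X (Prod P A B)),
      Fib = \<lambda>A. Fib P (Prod P X A),
      Reindex = \<lambda>(A, g). Reindex P (tuple P (Pr1 P X A) g)\<rparr>"

definition adjoin_arrow ::
  "('o, 'a, 'p) doctrine \<Rightarrow> 'o \<Rightarrow> ('o, 'a, 'p, 'o, 'o \<times> 'a, 'p) one_arrow" where
  "adjoin_arrow P X =
     \<lparr>on_obj = \<lambda>A\<in>Obj P. A,
      on_arr = \<lambda>f\<in>Arr P. (Dom P f, f \<cdot>\<^bsub>P\<^esub> Pr2 P X (Dom P f)),
      on_fib = \<lambda>A\<in>Obj P. \<lambda>\<alpha>\<in>carrier (Fib P A). Reindex P (Pr2 P X A) \<alpha>\<rparr>"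

text \<open>The arrow \<open>id\<^sub>X : \<^bold>t \<leadsto> X\<close>, under the identification of \<open>X \<times> \<^bold>t\<close> with \<open>X\<close>.\<close>

definition adjoin_const :: "('o, 'a, 'p) doctrine \<Rightarrow> 'o \<Rightarrow> 'o \<times> 'a" where
  "adjoin_const P X = (Term P, Pr1 P X (Term P))"

text \<open>The canonical isomorphism \<open>\<^bold>t \<cong> F \<^bold>t\<close>: the only arrow between these terminal objects.\<close>

definition term_iso ::
  "('o, 'a, 'p) doctrine \<Rightarrow> ('d, 'b, 'q) doctrine \<Rightarrow> ('o, 'a, 'p, 'd, 'b, 'q) one_arrow \<Rightarrow> 'b" where
  "term_iso P R F = (THE i. i \<in> hom R (Term R) (on_obj F (Term P)))"

definition extension_along ::
  "('o, 'a, 'p) doctrine \<Rightarrow> 'o \<Rightarrow> ('d, 'b, 'q) doctrine \<Rightarrow> ('o, 'a, 'p, 'd, 'b, 'q) one_arrow \<Rightarrow> 'b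
    \<Rightarrow> ('o, 'o \<times> 'a, 'p, 'd, 'b, 'q) one_arrow \<Rightarrow> bool" where
  "extension_along P X R G c H \<longleftrightarrow>
     one_arrow (adjoin P X) R H \<and>
     one_comp P H (adjoin_arrow P X) = G \<and>
     on_arr H (adjoin_const P X) \<cdot>\<^bsub>R\<^esub> term_iso (adjoin P X) R H = c"

end

theory Submission
  imports Defs
begin

text \<open>In the adjoined category every \<open>g : A \<leadsto> B\<close> is the composite of the image of
  \<open>g : X \<times> A \<rightarrow> B\<close> under \<open>F\<^sub>X\<close> with \<open>u\<^sub>A = id : A \<leadsto> X \<times> A\<close>, and every element of the fibre over
  \<open>A\<close> is the reindexing along \<open>u\<^sub>A\<close> of an element that comes from \<open>P\<close>. The arrow \<open>u\<^sub>A\<close> has components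
  \<open>id\<^sub>X\<close>, precomposed with \<open>A \<leadsto> \<^bold>t\<close>, and the identity of \<open>A\<close>, so an extension must send it to
  \<open>s\<^sub>A = \<langle>c \<cdot> !, id\<rangle> : G A \<rightarrow> G (X \<times> A)\<close>. This forces \<open>G' g = G g \<cdot> s\<^sub>A\<close> and
  \<open>\<gg>'\<^sub>A = R(s\<^sub>A) \<circ> \<gg>\<^bsub>X\<times>A\<^esub>\<close>; these formulas define an extension because
  \<open>G\<langle>pr\<^sub>1, g\<rangle> \<cdot> s\<^sub>A = s\<^sub>B \<cdot> G g \<cdot> s\<^sub>A\<close>. Extensions are thus equal, not only isomorphic, and a 2-cell
  whose whiskering with \<open>F\<^sub>X\<close> is the identity is itself the identity, as \<open>F\<^sub>X\<close> is the identity on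
  objects.\<close>

section \<open>Products in a category\<close>

lemma is_product_eqI:
  assumes "is_product C A B Q p q" "Z \<in> Obj C" "h \<in> hom C Z Q" "k \<in> hom C Z Q"
    and "p \<cdot>\<^bsub>C\<^esub> h = p \<cdot>\<^bsub>C\<^esub> k" "q \<cdot>\<^bsub>C\<^esub> h = q \<cdot>\<^bsub>C\<^esub> k"
    and "p \<cdot>\<^bsub>C\<^esub> k \<in> hom C Z A" "q \<cdot>\<^bsub>C\<^esub> k \<in> hom C Z B"
  shows "h = k"
  using assms unfolding is_product_def by metis

lemma is_product_ex:
  assumes "is_product C A B Q p q" "Z \<in> Obj C" "f \<in> hom C Z A" "g \<in> hom C Z B"
  obtains h where "h \<in> hom C Z Q" "p \<cdot>\<^bsub>C\<^esub> h = f" "q \<cdot>\<^bsub>C\<^esub> h = g"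
  using assms unfolding is_product_def by metis

context fp_category
begin

lemma hom_Obj:
  assumes "f \<in> hom C A B"
  shows "A \<in> Obj C" "B \<in> Obj C"
  using assms Dom_Obj Cod_Obj by (auto simp: hom_def)

lemma product_eqI:
  assumes "is_product C A B Q p q" "h \<in> hom C Z Q" "k \<in> hom C Z Q"
    and "p \<cdot> h = p \<cdot> k" "q \<cdot> h = q \<cdot> k"
  shows "h = k"
proof (rule is_product_eqI[OF assms(1) _ assms(2-5)])
  show "Z \<in> Obj C" "p \<cdot> k \<in> hom C Z A" "q \<cdot> k \<in> hom C Z B"
    using assms hom_Obj Comp_hom by (auto simp: is_product_def)
qed

lemma Pr_hom:
  assumes "A \<in> Obj C" "B \<in> Obj C"
  shows "Pr1 C A B \<in> hom C (Prod C A B) A" "Pr2 C A B \<in> hom C (Prod C A B) B"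
    and "Prod C A B \<in> Obj C"
  using Prod_product[OF assms] by (auto simp: is_product_def)

lemma tuple:
  assumes "f \<in> hom C Z A" "g \<in> hom C Z B"
  shows tuple_hom: "tuple C f g \<in> hom C Z (Prod C A B)"
    and Pr1_tuple: "Pr1 C A B \<cdot> tuple C f g = f"
    and Pr2_tuple: "Pr2 C A B \<cdot> tuple C f g = g"
proof -
  have dc: "Dom C f = Z" "Cod C f = A" "Cod C g = B"
    using assms by (auto simp: hom_def)
  have "\<exists>!h. h \<in> hom C Z (Prod C A B) \<and> Pr1 C A B \<cdot> h = f \<and> Pr2 C A B \<cdot> h = g"
    using Prod_product[of A B] assms hom_Obj unfolding is_product_def by blast
  from theI'[OF this]
  show "tuple C f g \<in> hom C Z (Prod C A B)" "Pr1 C A B \<cdot> tuple C f g = f"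
    "Pr2 C A B \<cdot> tuple C f g = g"
    unfolding tuple_def dc by auto
qed

lemma tuple_eqI:
  assumes "h \<in> hom C Z (Prod C A B)" "A \<in> Obj C" "B \<in> Obj C"
    and "Pr1 C A B \<cdot> h = f" "Pr2 C A B \<cdot> h = g"
  shows "tuple C f g = h"
proof -
  have fg: "f \<in> hom C Z A" "g \<in> hom C Z B"
    using assms Pr_hom[OF assms(2,3)] Comp_hom by blast+
  show ?thesis
    by (rule product_eqI[OF Prod_product[OF assms(2,3)] tuple_hom[OF fg] assms(1)])
      (simp_all add: Pr1_tuple[OF fg] Pr2_tuple[OF fg] assms)
qed

lemma tuple_Comp:
  assumes "f \<in> hom C Z A" "g \<in> hom C Z B" "k \<in> hom C Y Z"
  shows "tuple C f g \<cdot> k = tuple C (f \<cdot> k) (g \<cdot> k)"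
proof -
  have AB: "A \<in> Obj C" "B \<in> Obj C" using assms hom_Obj by blast+
  note t = tuple[OF assms(1,2)]
  have "Pr1 C A B \<cdot> (tuple C f g \<cdot> k) = f \<cdot> k" "Pr2 C A B \<cdot> (tuple C f g \<cdot> k) = g \<cdot> k"
    using Comp_assoc[OF assms(3) t(1) Pr_hom(1)[OF AB]]
      Comp_assoc[OF assms(3) t(1) Pr_hom(2)[OF AB]] t by simp_all
  then show ?thesis
    using tuple_eqI[OF Comp_hom[OF assms(3) t(1)] AB] by simp
qed

lemma tuple_Pr:
  assumes "A \<in> Obj C" "B \<in> Obj C"
  shows "tuple C (Pr1 C A B) (Pr2 C A B) = Id C (Prod C A B)"
  using tuple_eqI[OF Id_hom[OF Pr_hom(3)[OF assms]] assms] Comp_Id[OF Pr_hom(1)[OF assms]]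
    Comp_Id[OF Pr_hom(2)[OF assms]] by simp

section \<open>Terminal objects, and transport of universal properties along retractions\<close>

lemma terminal_eqI:
  assumes "is_terminal C T" "h \<in> hom C Z T" "k \<in> hom C Z T"
  shows "h = k"
  using assms hom_Obj unfolding is_terminal_def by blast

text \<open>Any \<open>k\<close> into \<open>T'\<close> equals \<open>u \<cdot> v \<cdot> k\<close>,
  and \<open>v \<cdot> k\<close> is the only arrow \<open>Z \<rightarrow> T\<close>, so a one-sided
  inverse is enough.\<close>

lemma terminal_retract:
  assumes T: "is_terminal C T" and u: "u \<in> hom C T T'" and v: "v \<in> hom C T' T"
    and uv: "u \<cdot> v = Id C T'"
  shows "is_terminal C T'"
  unfolding is_terminal_def
proof (intro conjI ballI)
  show "T' \<in> Obj C" using u hom_Obj by blast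
  fix Z assume "Z \<in> Obj C"
  then obtain h where h: "h \<in> hom C Z T" using T unfolding is_terminal_def by blast
  show "\<exists>!h. h \<in> hom C Z T'"
  proof (rule ex1I)
    show "u \<cdot> h \<in> hom C Z T'" using Comp_hom[OF h u] .
    fix k assume k: "k \<in> hom C Z T'"
    have "v \<cdot> k = h" by (rule terminal_eqI[OF T Comp_hom[OF k v] h])
    then show "k = u \<cdot> h" using Comp_assoc[OF k v u] uv Id_Comp[OF k] by simp
  qed
qed

text \<open>The same argument for products: since \<open>u \<cdot> v\<close> is an identity,
  \<open>p \<cdot> v = p'\<close> and \<open>q \<cdot> v = q'\<close>. A mediating arrow
  \<open>k\<close> into \<open>Q'\<close> therefore yields one into \<open>Q\<close>, namely
  \<open>v \<cdot> k\<close>, and is recovered from it by composing with \<open>u\<close>.\<close>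

lemma product_retract:
  assumes prod: "is_product C A B Q p q" and u: "u \<in> hom C Q Q'" and v: "v \<in> hom C Q' Q"
    and uv: "u \<cdot> v = Id C Q'"
    and p': "p' \<in> hom C Q' A" "p' \<cdot> u = p" and q': "q' \<in> hom C Q' B" "q' \<cdot> u = q"
  shows "is_product C A B Q' p' q'"
proof -
  have pq: "p \<in> hom C Q A" "q \<in> hom C Q B" using prod by (auto simp: is_product_def)
  have pqv: "p \<cdot> v = p'" "q \<cdot> v = q'"
    using Comp_assoc[OF v u p'(1)] Comp_assoc[OF v u q'(1)] uv p' q' Comp_Id by auto
  show ?thesis
    unfolding is_product_def
  proof (intro conjI ballI)
    show "Q' \<in> Obj C" using u hom_Obj by blast
    fix Z f g assume Z: "Z \<in> Obj C" and f: "f \<in> hom C Z A" and g: "g \<in> hom C Z B"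
    obtain h where h: "h \<in> hom C Z Q" "p \<cdot> h = f" "q \<cdot> h = g"
      using is_product_ex[OF prod Z f g] .
    show "\<exists>!h. h \<in> hom C Z Q' \<and> p' \<cdot> h = f \<and> q' \<cdot> h = g"
    proof (rule ex1I)
      show "u \<cdot> h \<in> hom C Z Q' \<and> p' \<cdot> u \<cdot> h = f \<and> q' \<cdot> u \<cdot> h = g"
        using Comp_hom[OF h(1) u] Comp_assoc[OF h(1) u p'(1)] Comp_assoc[OF h(1) u q'(1)]
          p' q' h by simp
      fix k assume k: "k \<in> hom C Z Q' \<and> p' \<cdot> k = f \<and> q' \<cdot> k = g"
      then have k1: "k \<in> hom C Z Q'" by blast
      have "v \<cdot> k = h"
      proof (rule product_eqI[OF prod Comp_hom[OF k1 v] h(1)])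
        show "p \<cdot> v \<cdot> k = p \<cdot> h" "q \<cdot> v \<cdot> k = q \<cdot> h"
          using Comp_assoc[OF k1 v pq(1)] Comp_assoc[OF k1 v pq(2)] k h pqv by simp_all
      qed
      then show "k = u \<cdot> h" using Comp_assoc[OF k1 v u] uv Id_Comp[OF k1] by simp
    qed
  qed (use p' q' in auto)
qed

end

section \<open>Functors between base categories: from chosen to arbitrary products\<close>

locale base_functor = S: fp_category C + T: fp_category D for C D +
  fixes Fo Fa
  assumes hom: "f \<in> hom C A B \<Longrightarrow> Fa f \<in> hom D (Fo A) (Fo B)"
    and Id: "A \<in> Obj C \<Longrightarrow> Fa (Id C A) = Id D (Fo A)"
    and Comp: "\<lbrakk>f \<in> hom C A B; g \<in> hom C B E\<rbrakk> \<Longrightarrow> Fa (g \<cdot>\<^bsub>C\<^esub> f) = Fa g \<cdot>\<^bsub>D\<^esub> Fa f"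
begin

text \<open>A 1-arrow has to preserve every terminal object, but any two are isomorphic and functors
  preserve retractions, so the chosen one decides.\<close>

lemma preserves_terminal:
  assumes "is_terminal D (Fo (Term C))" "is_terminal C T"
  shows "is_terminal D (Fo T)"
proof -
  obtain u v where uv: "u \<in> hom C (Term C) T" "v \<in> hom C T (Term C)"
    using assms(2) S.Term_terminal unfolding is_terminal_def by blast
  then have T: "T \<in> Obj C" using S.hom_Obj by blast
  have "u \<cdot>\<^bsub>C\<^esub> v = Id C T"
    using S.terminal_eqI[OF assms(2) S.Comp_hom[OF uv(2,1)] S.Id_hom[OF T]] .
  then have "Fa u \<cdot>\<^bsub>D\<^esub> Fa v = Id D (Fo T)" using Comp[OF uv(2,1)] Id[OF T] by simp
  then show ?thesis using T.terminal_retract[OF assms(1) hom[OF uv(1)] hom[OF uv(2)]] by simp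
qed

text \<open>The comparison arrows \<open>u\<close> and \<open>v\<close> between \<open>Q\<close> and
  the chosen product are mapped to a retraction compatible with the projections, to which
  \<open>product_retract\<close> applies.\<close>

lemma preserves_product:
  assumes AB: "A \<in> Obj C" "B \<in> Obj C"
    and FP: "is_product D (Fo A) (Fo B) (Fo (Prod C A B)) (Fa (Pr1 C A B)) (Fa (Pr2 C A B))"
    and Q: "is_product C A B Q p q"
  shows "is_product D (Fo A) (Fo B) (Fo Q) (Fa p) (Fa q)"
proof -
  have pq: "Q \<in> Obj C" "p \<in> hom C Q A" "q \<in> hom C Q B" using Q by (auto simp: is_product_def)
  note Pr = S.Pr_hom[OF AB]
  obtain u where u: "u \<in> hom C (Prod C A B) Q" "p \<cdot>\<^bsub>C\<^esub> u = Pr1 C A B" "q \<cdot>\<^bsub>C\<^esub> u = Pr2 C A B"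
    using is_product_ex[OF Q Pr(3,1,2)] .
  obtain v where v: "v \<in> hom C Q (Prod C A B)" "Pr1 C A B \<cdot>\<^bsub>C\<^esub> v = p" "Pr2 C A B \<cdot>\<^bsub>C\<^esub> v = q"
    using is_product_ex[OF S.Prod_product[OF AB] pq] .
  have "u \<cdot>\<^bsub>C\<^esub> v = Id C Q"
  proof (rule S.product_eqI[OF Q S.Comp_hom[OF v(1) u(1)] S.Id_hom[OF pq(1)]])
    show "p \<cdot>\<^bsub>C\<^esub> u \<cdot>\<^bsub>C\<^esub> v = p \<cdot>\<^bsub>C\<^esub> Id C Q" "q \<cdot>\<^bsub>C\<^esub> u \<cdot>\<^bsub>C\<^esub> v = q \<cdot>\<^bsub>C\<^esub> Id C Q"
      using S.Comp_assoc[OF v(1) u(1) pq(2)] S.Comp_assoc[OF v(1) u(1) pq(3)] u v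
        S.Comp_Id[OF pq(2)] S.Comp_Id[OF pq(3)] by simp_all
  qed
  then have "Fa u \<cdot>\<^bsub>D\<^esub> Fa v = Id D (Fo Q)" using Comp[OF v(1) u(1)] Id[OF pq(1)] by simp
  then show ?thesis
    using T.product_retract[OF FP hom[OF u(1)] hom[OF v(1)] _ hom[OF pq(2)] _ hom[OF pq(3)]]
      Comp[OF u(1) pq(2)] Comp[OF u(1) pq(3)] u by simp
qed

end

section \<open>The doctrine with an adjoined constant\<close>

lemma adjoin_simps [simp]:
  "Obj (adjoin P X) = Obj P" "Dom (adjoin P X) (A, g) = A" "Cod (adjoin P X) (A, g) = Cod P g"
  "Id (adjoin P X) A = (A, Pr2 P X A)"
  "(B, h) \<cdot>\<^bsub>adjoin P X\<^esub> (A, g) = (A, h \<cdot>\<^bsub>P\<^esub> tuple P (Pr1 P X A) g)"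
  "Term (adjoin P X) = Term P" "Prod (adjoin P X) = Prod P"
  "Pr1 (adjoin P X) A B = (Prod P A B, Pr1 P A B \<cdot>\<^bsub>P\<^esub> Pr2 P X (Prod P A B))"
  "Pr2 (adjoin P X) A B = (Prod P A B, Pr2 P A B \<cdot>\<^bsub>P\<^esub> Pr2 P X (Prod P A B))"
  "Fib (adjoin P X) A = Fib P (Prod P X A)"
  "Reindex (adjoin P X) (A, g) = Reindex P (tuple P (Pr1 P X A) g)"
  by (simp_all add: adjoin_def)

lemma hom_adjoin: "x \<in> hom (adjoin P X) A B \<longleftrightarrow>
    A \<in> Obj P \<and> (\<exists>g \<in> hom P (Prod P X A) B. x = (A, g))"
  by (cases x) (auto simp: adjoin_def hom_def)

locale adjoined_constant = doctrine P for P :: "('o, 'a, 'p) doctrine" (structure) +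
  fixes X
  assumes X: "X \<in> Obj P"
begin

section \<open>Coextension of arrows for the comonad \<open>X \<times> -\<close>, whose coKleisli
  category is the adjoined one\<close>

abbreviation lift where "lift A g \<equiv> tuple P (Pr1 P X A) g"

lemma lift:
  assumes "A \<in> Obj P" "g \<in> hom P (Prod P X A) B"
  shows "lift A g \<in> hom P (Prod P X A) (Prod P X B)"
    "Pr1 P X B \<cdot> lift A g = Pr1 P X A" "Pr2 P X B \<cdot> lift A g = g"
  using tuple[OF Pr_hom(1)[OF X assms(1)] assms(2)] by auto

text \<open>Pairings compose componentwise and \<open>lift A g\<close> keeps the
  \<open>X\<close>-component. This gives both associativity in the adjoined category and
  functoriality of its reindexing.\<close>

lemma lift_Comp:
  assumes "A \<in> Obj P" "g \<in> hom P (Prod P X A) B" "h \<in> hom P (Prod P X B) E"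
  shows "lift A (h \<cdot> lift A g) = lift B h \<cdot> lift A g"
proof -
  have B: "B \<in> Obj P" using assms hom_Obj by blast
  show ?thesis
    using tuple_Comp[OF Pr_hom(1)[OF X B] assms(3) lift(1)[OF assms(1,2)]] lift(2)[OF assms(1,2)]
    by simp
qed

text \<open>An arrow coming from \<open>P\<close> ignores the parameter in \<open>X\<close>, so
  composing with it in the adjoined category is plain composition in \<open>P\<close>.\<close>

lemma Comp_Pr2_lift:
  assumes "A \<in> Obj P" "g \<in> hom P (Prod P X A) B" "f \<in> hom P B E"
  shows "(f \<cdot> Pr2 P X B) \<cdot> lift A g = f \<cdot> g"
proof -
  have B: "B \<in> Obj P" using assms hom_Obj by blast
  show ?thesis
    using Comp_assoc[OF lift(1)[OF assms(1,2)] Pr_hom(2)[OF X B] assms(3)] lift(3)[OF assms(1,2)]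
    by simp
qed

text \<open>The unit laws rest on \<open>lift A (Pr2 P X A)\<close> being an identity, associativity
  on \<open>lift_Comp\<close>. The universal properties over \<open>Z\<close> are those of
  \<open>P\<close> over \<open>Prod P X Z\<close>.\<close>

lemma fp_category_adjoin: "fp_category (adjoin P X)"
proof
  fix x assume "x \<in> Arr (adjoin P X)"
  then have "x \<in> hom (adjoin P X) (Dom (adjoin P X) x) (Cod (adjoin P X) x)" by (simp add: hom_def)
  then show "Dom (adjoin P X) x \<in> Obj (adjoin P X)" "Cod (adjoin P X) x \<in> Obj (adjoin P X)"
    using hom_Obj unfolding hom_adjoin by auto
next
  fix A assume "A \<in> Obj (adjoin P X)"
  then show "Id (adjoin P X) A \<in> hom (adjoin P X) A A"
    using Pr_hom[OF X] by (simp add: hom_adjoin)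
next
  fix f A B g E assume "f \<in> hom (adjoin P X) A B" "g \<in> hom (adjoin P X) B E"
  then show "g \<cdot>\<^bsub>adjoin P X\<^esub> f \<in> hom (adjoin P X) A E"
    using Comp_hom[OF lift(1)] by (auto simp: hom_adjoin)
next
  fix f A B assume "f \<in> hom (adjoin P X) A B"
  then show "f \<cdot>\<^bsub>adjoin P X\<^esub> Id (adjoin P X) A = f" "Id (adjoin P X) B \<cdot>\<^bsub>adjoin P X\<^esub> f = f"
    using tuple_Pr[OF X] Comp_Id lift(3) by (auto simp: hom_adjoin)
next
  fix f A B g E h K
  assume "f \<in> hom (adjoin P X) A B" "g \<in> hom (adjoin P X) B E" "h \<in> hom (adjoin P X) E K"
  then obtain f' g' h' where A: "A \<in> Obj P" "B \<in> Obj P" "E \<in> Obj P"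
    and f: "f = (A, f')" "f' \<in> hom P (Prod P X A) B"
    and g: "g = (B, g')" "g' \<in> hom P (Prod P X B) E"
    and h: "h = (E, h')" "h' \<in> hom P (Prod P X E) K"
    by (auto simp: hom_adjoin)
  show "(h \<cdot>\<^bsub>adjoin P X\<^esub> g) \<cdot>\<^bsub>adjoin P X\<^esub> f = h \<cdot>\<^bsub>adjoin P X\<^esub> g \<cdot>\<^bsub>adjoin P X\<^esub> f"
    using Comp_assoc[OF lift(1)[OF A(1) f(2)] lift(1)[OF A(2) g(2)] h(2)]
      lift_Comp[OF A(1) f(2) g(2)] by (simp add: f g h)
next
  show "is_terminal (adjoin P X) \<^bold>t\<^bsub>adjoin P X\<^esub>"
    unfolding is_terminal_def
  proof (intro conjI ballI)
    show "\<^bold>t\<^bsub>adjoin P X\<^esub> \<in> Obj (adjoin P X)" using Term_terminal by (simp add: is_terminal_def)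
    fix Z assume "Z \<in> Obj (adjoin P X)"
    then have Z: "Z \<in> Obj P" "Prod P X Z \<in> Obj P" using Pr_hom[OF X] by auto
    then have "\<exists>!h. h \<in> hom P (Prod P X Z) (Term P)"
      using Term_terminal by (simp add: is_terminal_def)
    then show "\<exists>!h. h \<in> hom (adjoin P X) Z \<^bold>t\<^bsub>adjoin P X\<^esub>"
      using Z by (auto simp: hom_adjoin)
  qed
next
  fix A B assume "A \<in> Obj (adjoin P X)" "B \<in> Obj (adjoin P X)"
  then have AB: "A \<in> Obj P" "B \<in> Obj P" by auto
  note Q = Pr_hom[OF AB]
  note XQ = Pr_hom[OF X Q(3)]
  show "is_product (adjoin P X) A B (Prod (adjoin P X) A B) (Pr1 (adjoin P X) A B)
      (Pr2 (adjoin P X) A B)"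
    unfolding is_product_def
  proof (intro conjI ballI)
    show "Prod (adjoin P X) A B \<in> Obj (adjoin P X)"
      "Pr1 (adjoin P X) A B \<in> hom (adjoin P X) (Prod (adjoin P X) A B) A"
      "Pr2 (adjoin P X) A B \<in> hom (adjoin P X) (Prod (adjoin P X) A B) B"
      using Q XQ Comp_hom by (auto simp: hom_adjoin)
    fix Z f g
    assume "Z \<in> Obj (adjoin P X)" "f \<in> hom (adjoin P X) Z A" "g \<in> hom (adjoin P X) Z B"
    then obtain f' g' where Z: "Z \<in> Obj P"
      and f: "f = (Z, f')" "f' \<in> hom P (Prod P X Z) A"
      and g: "g = (Z, g')" "g' \<in> hom P (Prod P X Z) B"
      by (auto simp: hom_adjoin)
    \<comment> \<open>The projections come from \<open>P\<close>, so by \<open>Comp_Pr2_lift\<close>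
      the conditions on a mediating arrow become those for the product of \<open>A\<close> and
      \<open>B\<close> in \<open>P\<close>.\<close>
    have *: "h \<in> hom (adjoin P X) Z (Prod (adjoin P X) A B) \<and>
        Pr1 (adjoin P X) A B \<cdot>\<^bsub>adjoin P X\<^esub> h = f \<and> Pr2 (adjoin P X) A B \<cdot>\<^bsub>adjoin P X\<^esub> h = g
      \<longleftrightarrow> (\<exists>h'. h = (Z, h') \<and> h' \<in> hom P (Prod P X Z) (Prod P A B) \<and>
        Pr1 P A B \<cdot> h' = f' \<and> Pr2 P A B \<cdot> h' = g')" for h
      using Z Comp_Pr2_lift[OF Z _ Q(1)] Comp_Pr2_lift[OF Z _ Q(2)]
      by (auto simp: hom_adjoin f g)
    show "\<exists>!h. h \<in> hom (adjoin P X) Z (Prod (adjoin P X) A B) \<and>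
        Pr1 (adjoin P X) A B \<cdot>\<^bsub>adjoin P X\<^esub> h = f \<and> Pr2 (adjoin P X) A B \<cdot>\<^bsub>adjoin P X\<^esub> h = g"
      unfolding *
    proof (rule ex1I)
      show "\<exists>h'. (Z, tuple P f' g') = (Z, h') \<and> h' \<in> hom P (Prod P X Z) (Prod P A B) \<and>
          Pr1 P A B \<cdot> h' = f' \<and> Pr2 P A B \<cdot> h' = g'"
        using tuple[OF f(2) g(2)] by blast
      fix h assume "\<exists>h'. h = (Z, h') \<and> h' \<in> hom P (Prod P X Z) (Prod P A B) \<and>
          Pr1 P A B \<cdot> h' = f' \<and> Pr2 P A B \<cdot> h' = g'"
      then obtain h' where "h = (Z, h')" "h' \<in> hom P (Prod P X Z) (Prod P A B)"
        "Pr1 P A B \<cdot> h' = f'" "Pr2 P A B \<cdot> h' = g'" by blast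
      then show "h = (Z, tuple P f' g')" using tuple_eqI[OF _ AB] by simp
    qed
  qed
qed

lemma doctrine_adjoin: "doctrine (adjoin P X)"
proof (intro doctrine.intro doctrine_axioms.intro fp_category_adjoin)
  fix A assume "A \<in> Obj (adjoin P X)"
  then show "partial_order (Fib (adjoin P X) A)" using Fib_poset Pr_hom[OF X] by simp
next
  fix f A B assume "f \<in> hom (adjoin P X) A B"
  then obtain f' where "A \<in> Obj P" "f = (A, f')" "f' \<in> hom P (Prod P X A) B"
    by (auto simp: hom_adjoin)
  then show "Reindex (adjoin P X) f \<in> carrier (Fib (adjoin P X) B) \<rightarrow> carrier (Fib (adjoin P X) A)"
    "isotone (Fib (adjoin P X) B) (Fib (adjoin P X) A) (Reindex (adjoin P X) f)"
    using Reindex_carrier[OF lift(1)] Reindex_isotone[OF lift(1)] by simp_all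
next
  fix A \<alpha> assume "A \<in> Obj (adjoin P X)" "\<alpha> \<in> carrier (Fib (adjoin P X) A)"
  then show "Reindex (adjoin P X) (Id (adjoin P X) A) \<alpha> = \<alpha>"
    using Reindex_Id Pr_hom[OF X] tuple_Pr[OF X] by simp
next
  fix f A B g E \<alpha>
  assume "f \<in> hom (adjoin P X) A B" "g \<in> hom (adjoin P X) B E"
    "\<alpha> \<in> carrier (Fib (adjoin P X) E)"
  then obtain f' g' where "A \<in> Obj P" "B \<in> Obj P" "f = (A, f')" "g = (B, g')"
    "f' \<in> hom P (Prod P X A) B" "g' \<in> hom P (Prod P X B) E"
    "\<alpha> \<in> carrier (Fib P (Prod P X E))"
    by (auto simp: hom_adjoin)
  then show "Reindex (adjoin P X) (g \<cdot>\<^bsub>adjoin P X\<^esub> f) \<alpha> =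
      Reindex (adjoin P X) f (Reindex (adjoin P X) g \<alpha>)"
    using lift_Comp Reindex_Comp[OF lift(1) lift(1)] by simp
qed

section \<open>The canonical 1-arrow into the adjoined doctrine, and the generic constant\<close>

lemma on_obj_adjoin_arrow: "A \<in> Obj P \<Longrightarrow> on_obj (adjoin_arrow P X) A = A"
  by (simp add: adjoin_arrow_def)

lemma on_arr_adjoin_arrow:
  "f \<in> hom P A B \<Longrightarrow> on_arr (adjoin_arrow P X) f = (A, f \<cdot> Pr2 P X A)"
  by (auto simp: adjoin_arrow_def hom_def)

lemma on_fib_adjoin_arrow:
  "\<lbrakk>A \<in> Obj P; \<alpha> \<in> carrier (Fib P A)\<rbrakk> \<Longrightarrow>
    on_fib (adjoin_arrow P X) A \<alpha> = Reindex P (Pr2 P X A) \<alpha>"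
  by (simp add: adjoin_arrow_def)

lemma adjoin_arrow_hom:
  assumes "f \<in> hom P A B"
  shows "on_arr (adjoin_arrow P X) f \<in> hom (adjoin P X) A B"
  using assms Comp_hom[OF Pr_hom(2)[OF X] assms] hom_Obj[OF assms]
  by (simp add: on_arr_adjoin_arrow hom_adjoin)

text \<open>The chosen terminal object and the chosen product diagrams are sent exactly to the
  chosen ones, so \<open>base_functor\<close> yields preservation of all of them.\<close>

lemma one_arrow_adjoin_arrow: "one_arrow P (adjoin P X) (adjoin_arrow P X)"
proof -
  interpret S: doctrine "adjoin P X" by (rule doctrine_adjoin)
  let ?F = "adjoin_arrow P X"
  interpret F: base_functor P "adjoin P X" "on_obj ?F" "on_arr ?F"
  proof
    fix f A B assume f: "f \<in> hom P A B"
    then show "on_arr ?F f \<in> hom (adjoin P X) (on_obj ?F A) (on_obj ?F B)"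
      using adjoin_arrow_hom[OF f] hom_Obj[OF f] by (simp add: on_obj_adjoin_arrow)
  next
    fix A assume A: "A \<in> Obj P"
    then show "on_arr ?F (Id P A) = Id (adjoin P X) (on_obj ?F A)"
      using on_arr_adjoin_arrow[OF Id_hom[OF A]] Id_Comp[OF Pr_hom(2)[OF X A]]
      by (simp add: on_obj_adjoin_arrow)
  next
    fix f A B g E assume f: "f \<in> hom P A B" and g: "g \<in> hom P B E"
    have A: "A \<in> Obj P" using hom_Obj f by blast
    show "on_arr ?F (g \<cdot> f) = on_arr ?F g \<cdot>\<^bsub>adjoin P X\<^esub> on_arr ?F f"
      using Comp_Pr2_lift[OF A Comp_hom[OF Pr_hom(2)[OF X A] f] g]
        Comp_assoc[OF Pr_hom(2)[OF X A] f g]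
      by (simp add: on_arr_adjoin_arrow[OF f] on_arr_adjoin_arrow[OF g]
          on_arr_adjoin_arrow[OF Comp_hom[OF f g]])
  qed
  have Term: "Term P \<in> Obj P" using Term_terminal by (simp add: is_terminal_def)
  show ?thesis
  proof
    show "on_obj ?F \<in> Obj P \<rightarrow>\<^sub>E Obj (adjoin P X)" "on_arr ?F \<in> extensional (Arr P)"
      "on_fib ?F \<in> extensional (Obj P)"
      by (auto simp: adjoin_arrow_def)
    show "is_terminal (adjoin P X) (on_obj ?F T)" if "is_terminal P T" for T
      using F.preserves_terminal[OF _ that] S.Term_terminal Term by (simp add: on_obj_adjoin_arrow)
    show "is_product (adjoin P X) (on_obj ?F A) (on_obj ?F B) (on_obj ?F Q) (on_arr ?F p)
        (on_arr ?F q)" if "A \<in> Obj P" "B \<in> Obj P" "is_product P A B Q p q" for A B Q p q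
      using F.preserves_product[OF that(1,2) _ that(3)] S.Prod_product[of A B]
        Pr_hom[OF that(1,2)] that
      by (simp add: on_obj_adjoin_arrow on_arr_adjoin_arrow)
    fix A assume A: "A \<in> Obj P"
    note r = Reindex_carrier[OF Pr_hom(2)[OF X A]] Reindex_isotone[OF Pr_hom(2)[OF X A]]
    show "on_fib ?F A \<in> carrier (Fib P A) \<rightarrow>\<^sub>E carrier (Fib (adjoin P X) (on_obj ?F A))"
      using A r(1) by (auto simp: adjoin_arrow_def)
    show "isotone (Fib P A) (Fib (adjoin P X) (on_obj ?F A)) (on_fib ?F A)"
      using A r(2) by (simp add: isotone_def on_obj_adjoin_arrow on_fib_adjoin_arrow)
  next
    fix f A B \<alpha> assume f: "f \<in> hom P A B" and \<alpha>: "\<alpha> \<in> carrier (Fib P B)"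
    have AB: "A \<in> Obj P" "B \<in> Obj P" using hom_Obj f by blast+
    note fA = Comp_hom[OF Pr_hom(2)[OF X AB(1)] f]
    have "Reindex P f \<alpha> \<in> carrier (Fib P A)" using Reindex_carrier[OF f] \<alpha> by blast
    \<comment> \<open>Both sides are the reindexing of \<open>\<alpha>\<close> along
      \<open>f \<cdot> Pr2 P X A\<close>.\<close>
    then show "on_fib ?F A (Reindex P f \<alpha>) = Reindex (adjoin P X) (on_arr ?F f) (on_fib ?F B \<alpha>)"
      using AB \<alpha> Reindex_Comp[OF Pr_hom(2)[OF X AB(1)] f \<alpha>]
        Reindex_Comp[OF lift(1)[OF AB(1) fA] Pr_hom(2)[OF X AB(2)] \<alpha>] lift(3)[OF AB(1) fA]
      by (simp add: on_arr_adjoin_arrow[OF f] on_fib_adjoin_arrow)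
  qed (fact F.hom F.Id F.Comp)+
qed

lemma adjoin_const_hom: "adjoin_const P X \<in> hom (adjoin P X) (Term (adjoin P X)) X"
proof -
  have "Term P \<in> Obj P" using Term_terminal by (simp add: is_terminal_def)
  then show ?thesis using Pr_hom[OF X] by (simp add: adjoin_const_def hom_adjoin)
qed

end

section \<open>The universal property\<close>

locale extension_problem = adjoined_constant P X + R: doctrine R + G: one_arrow P R G
  for P :: "('o, 'a, 'p) doctrine" (structure) and X and R :: "('d, 'b, 'q) doctrine" and G +
  fixes c
  assumes c: "c \<in> hom R (Term R) (on_obj G X)"
begin

section \<open>Inserting the constant \<open>c\<close> into the image of a product with
  \<open>X\<close>\<close>

definition bang where "bang Z = (THE h. h \<in> hom R Z (Term R))"

lemma bang_hom:
  assumes "Z \<in> Obj R"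
  shows "bang Z \<in> hom R Z (Term R)"
proof -
  have "\<exists>!h. h \<in> hom R Z (Term R)"
    using R.Term_terminal assms unfolding is_terminal_def by (elim conjE bspec)
  from theI'[OF this] show ?thesis unfolding bang_def .
qed

lemma bang_Comp:
  assumes "f \<in> hom R Y Z"
  shows "bang Z \<cdot>\<^bsub>R\<^esub> f = bang Y"
  by (rule R.terminal_eqI[OF R.Term_terminal R.Comp_hom[OF assms bang_hom] bang_hom])
    (rule R.hom_Obj[OF assms])+

lemma const_bang_Comp:
  assumes "f \<in> hom R Y Z"
  shows "(c \<cdot>\<^bsub>R\<^esub> bang Z) \<cdot>\<^bsub>R\<^esub> f = c \<cdot>\<^bsub>R\<^esub> bang Y"
  using R.Comp_assoc[OF assms bang_hom c] R.hom_Obj[OF assms] bang_Comp[OF assms] by simp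

lemma G_Obj: "A \<in> Obj P \<Longrightarrow> on_obj G A \<in> Obj R"
  using G.on_obj_Obj by blast

lemma G_product:
  assumes "A \<in> Obj P" "B \<in> Obj P"
  shows "is_product R (on_obj G A) (on_obj G B) (on_obj G (Prod P A B))
    (on_arr G (Pr1 P A B)) (on_arr G (Pr2 P A B))"
  using G.preserves_product[OF assms Prod_product[OF assms]] .

text \<open>The arrow \<open>s\<^sub>A\<close> of the introduction.\<close>

definition insert_const where
  "insert_const A = (THE h. h \<in> hom R (on_obj G A) (on_obj G (Prod P X A)) \<and>
     on_arr G (Pr1 P X A) \<cdot>\<^bsub>R\<^esub> h = c \<cdot>\<^bsub>R\<^esub> bang (on_obj G A) \<and>
     on_arr G (Pr2 P X A) \<cdot>\<^bsub>R\<^esub> h = Id R (on_obj G A))"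

text \<open>Since \<open>G\<close> preserves products, its image of \<open>Prod P X A\<close> is a
  product of the images of \<open>X\<close> and \<open>A\<close>, which makes the description in the
  definition unique.\<close>

lemma insert_const:
  assumes A: "A \<in> Obj P"
  shows insert_const_hom: "insert_const A \<in> hom R (on_obj G A) (on_obj G (Prod P X A))"
    and Pr1_insert_const:
      "on_arr G (Pr1 P X A) \<cdot>\<^bsub>R\<^esub> insert_const A = c \<cdot>\<^bsub>R\<^esub> bang (on_obj G A)"
    and Pr2_insert_const: "on_arr G (Pr2 P X A) \<cdot>\<^bsub>R\<^esub> insert_const A = Id R (on_obj G A)"
proof -
  have "\<exists>!h. h \<in> hom R (on_obj G A) (on_obj G (Prod P X A)) \<and>
     on_arr G (Pr1 P X A) \<cdot>\<^bsub>R\<^esub> h = c \<cdot>\<^bsub>R\<^esub> bang (on_obj G A) \<and>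
     on_arr G (Pr2 P X A) \<cdot>\<^bsub>R\<^esub> h = Id R (on_obj G A)"
    using G_product[OF X A] G_Obj[OF A] R.Comp_hom[OF bang_hom[OF G_Obj[OF A]] c]
      R.Id_hom[OF G_Obj[OF A]] unfolding is_product_def by blast
  from theI'[OF this]
  show "insert_const A \<in> hom R (on_obj G A) (on_obj G (Prod P X A))"
    "on_arr G (Pr1 P X A) \<cdot>\<^bsub>R\<^esub> insert_const A = c \<cdot>\<^bsub>R\<^esub> bang (on_obj G A)"
    "on_arr G (Pr2 P X A) \<cdot>\<^bsub>R\<^esub> insert_const A = Id R (on_obj G A)"
    unfolding insert_const_def by auto
qed

text \<open>An arrow whose \<open>X\<close>-component is constantly \<open>c\<close> is determined
  by its \<open>A\<close>-component: the constant is unchanged by precomposition, so both sides have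
  the same two components.\<close>

lemma insert_const_eqI:
  assumes A: "A \<in> Obj P" and h: "h \<in> hom R Z (on_obj G (Prod P X A))"
    and "on_arr G (Pr1 P X A) \<cdot>\<^bsub>R\<^esub> h = c \<cdot>\<^bsub>R\<^esub> bang Z" and k: "k \<in> hom R Z (on_obj G A)"
    and "on_arr G (Pr2 P X A) \<cdot>\<^bsub>R\<^esub> h = k"
  shows "h = insert_const A \<cdot>\<^bsub>R\<^esub> k"
proof (rule R.product_eqI[OF G_product[OF X A] h R.Comp_hom[OF k insert_const_hom[OF A]]])
  note s = insert_const[OF A]
  note Pr = Pr_hom(1,2)[OF X A, THEN G.on_arr_hom]
  show "on_arr G (Pr1 P X A) \<cdot>\<^bsub>R\<^esub> h = on_arr G (Pr1 P X A) \<cdot>\<^bsub>R\<^esub> insert_const A \<cdot>\<^bsub>R\<^esub> k"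
    "on_arr G (Pr2 P X A) \<cdot>\<^bsub>R\<^esub> h = on_arr G (Pr2 P X A) \<cdot>\<^bsub>R\<^esub> insert_const A \<cdot>\<^bsub>R\<^esub> k"
    by (simp_all only: assms(3,5) s(2,3) R.Comp_assoc[OF k s(1) Pr(1), symmetric]
        R.Comp_assoc[OF k s(1) Pr(2), symmetric] const_bang_Comp[OF k] R.Id_Comp[OF k])
qed

text \<open>\<open>lift A g\<close> leaves the \<open>X\<close>-component alone, so after
  \<open>insert_const A\<close> that component is still the constant \<open>c\<close>. This equation
  gives the extension both its functoriality and its naturality on fibres.\<close>

lemma lift_insert_const:
  assumes A: "A \<in> Obj P" and g: "g \<in> hom P (Prod P X A) B"
  shows "on_arr G (lift A g) \<cdot>\<^bsub>R\<^esub> insert_const A =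
    insert_const B \<cdot>\<^bsub>R\<^esub> on_arr G g \<cdot>\<^bsub>R\<^esub> insert_const A"
proof (rule insert_const_eqI)
  show B: "B \<in> Obj P" using hom_Obj g by blast
  note s = insert_const[OF A]
  note l = lift[OF A g]
  show "on_arr G (lift A g) \<cdot>\<^bsub>R\<^esub> insert_const A \<in> hom R (on_obj G A) (on_obj G (Prod P X B))"
    "on_arr G g \<cdot>\<^bsub>R\<^esub> insert_const A \<in> hom R (on_obj G A) (on_obj G B)"
    using R.Comp_hom[OF s(1) G.on_arr_hom] l g by blast+
  note Pr = Pr_hom[OF X B]
  show "on_arr G (Pr1 P X B) \<cdot>\<^bsub>R\<^esub> on_arr G (lift A g) \<cdot>\<^bsub>R\<^esub> insert_const A
      = c \<cdot>\<^bsub>R\<^esub> bang (on_obj G A)"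
    "on_arr G (Pr2 P X B) \<cdot>\<^bsub>R\<^esub> on_arr G (lift A g) \<cdot>\<^bsub>R\<^esub> insert_const A
      = on_arr G g \<cdot>\<^bsub>R\<^esub> insert_const A"
    by (simp_all only: l(2,3) s(2)
        R.Comp_assoc[OF s(1) G.on_arr_hom[OF l(1)] G.on_arr_hom[OF Pr(1)], symmetric]
        R.Comp_assoc[OF s(1) G.on_arr_hom[OF l(1)] G.on_arr_hom[OF Pr(2)], symmetric]
        G.on_arr_Comp[OF l(1) Pr(1), symmetric] G.on_arr_Comp[OF l(1) Pr(2), symmetric])
qed

section \<open>Existence of the extension\<close>

definition extension where
  "extension =
     \<lparr>on_obj = on_obj G,
      on_arr = \<lambda>(A, g)\<in>Arr (adjoin P X). on_arr G g \<cdot>\<^bsub>R\<^esub> insert_const A,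
      on_fib = \<lambda>A\<in>Obj P. \<lambda>\<alpha>\<in>carrier (Fib P (Prod P X A)).
        Reindex R (insert_const A) (on_fib G (Prod P X A) \<alpha>)\<rparr>"

lemma on_obj_extension [simp]: "on_obj extension = on_obj G"
  by (simp add: extension_def)

lemma on_arr_extension:
  assumes "A \<in> Obj P" "g \<in> hom P (Prod P X A) B"
  shows "on_arr extension (A, g) = on_arr G g \<cdot>\<^bsub>R\<^esub> insert_const A"
  using assms by (auto simp: extension_def adjoin_def hom_def)

lemma on_fib_extension:
  "\<lbrakk>A \<in> Obj P; \<alpha> \<in> carrier (Fib P (Prod P X A))\<rbrakk> \<Longrightarrow>
    on_fib extension A \<alpha> = Reindex R (insert_const A) (on_fib G (Prod P X A) \<alpha>)"
  by (simp add: extension_def)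

text \<open>\<open>insert_const A\<close> is a section of the image of \<open>Pr2 P X A\<close>, so
  the two cancel. Used for the projections of products and for the restriction to
  \<open>P\<close>.\<close>

lemma on_arr_extension_Pr2:
  assumes A: "A \<in> Obj P" and f: "f \<in> hom P A B"
  shows "on_arr extension (A, f \<cdot> Pr2 P X A) = on_arr G f"
  using on_arr_extension[OF A Comp_hom[OF Pr_hom(2)[OF X A] f]]
    G.on_arr_Comp[OF Pr_hom(2)[OF X A] f] Pr2_insert_const[OF A] R.Comp_Id[OF G.on_arr_hom[OF f]]
    R.Comp_assoc[OF insert_const_hom[OF A] G.on_arr_hom[OF Pr_hom(2)[OF X A]] G.on_arr_hom[OF f]]
  by simp

text \<open>Terminal objects and products are inherited from \<open>G\<close>, since objects and
  projections have the same images under both; on fibres the maps are composites of monotone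
  maps.\<close>

lemma one_arrow_extension: "one_arrow (adjoin P X) R extension"
proof -
  interpret S: doctrine "adjoin P X" by (rule doctrine_adjoin)
  interpret E: base_functor "adjoin P X" R "on_obj extension" "on_arr extension"
  proof
    fix f A B assume "f \<in> hom (adjoin P X) A B"
    then show "on_arr extension f \<in> hom R (on_obj extension A) (on_obj extension B)"
      using R.Comp_hom[OF insert_const_hom G.on_arr_hom] by (auto simp: hom_adjoin on_arr_extension)
  next
    fix A assume "A \<in> Obj (adjoin P X)"
    then show "on_arr extension (Id (adjoin P X) A) = Id R (on_obj extension A)"
      using on_arr_extension[OF _ Pr_hom(2)[OF X]] Pr2_insert_const by simp
  next
    fix f A B g K assume "f \<in> hom (adjoin P X) A B" "g \<in> hom (adjoin P X) B K"
    then obtain f' g' where AB: "A \<in> Obj P" "B \<in> Obj P"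
      and f: "f = (A, f')" "f' \<in> hom P (Prod P X A) B"
      and g: "g = (B, g')" "g' \<in> hom P (Prod P X B) K"
      by (auto simp: hom_adjoin)
    note l = lift[OF AB(1) f(2)]
    note sA = insert_const_hom[OF AB(1)]
    \<comment> \<open>The composite is sent to the image of \<open>g' \<cdot> lift A f'\<close>
      after \<open>insert_const A\<close>; \<open>lift_insert_const\<close> moves the insertion past
      the lift, turning it into \<open>insert_const B\<close>.\<close>
    show "on_arr extension (g \<cdot>\<^bsub>adjoin P X\<^esub> f) = on_arr extension g \<cdot>\<^bsub>R\<^esub> on_arr extension f"
      by (simp only: f(1) g(1) adjoin_simps on_arr_extension[OF AB(1) Comp_hom[OF l(1) g(2)]]
          on_arr_extension[OF AB(1) f(2)] on_arr_extension[OF AB(2) g(2)]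
          G.on_arr_Comp[OF l(1) g(2)] lift_insert_const[OF AB(1) f(2)]
          R.Comp_assoc[OF sA G.on_arr_hom[OF l(1)] G.on_arr_hom[OF g(2)]]
          R.Comp_assoc[OF R.Comp_hom[OF sA G.on_arr_hom[OF f(2)]] insert_const_hom[OF AB(2)]
            G.on_arr_hom[OF g(2)]])
  qed
  show ?thesis
  proof
    show "on_obj extension \<in> Obj (adjoin P X) \<rightarrow>\<^sub>E Obj R" using G.on_obj_Obj by simp
    show "on_arr extension \<in> extensional (Arr (adjoin P X))"
      "on_fib extension \<in> extensional (Obj (adjoin P X))"
      by (auto simp: extension_def)
    show "is_terminal R (on_obj extension T)" if "is_terminal (adjoin P X) T" for T
      using E.preserves_terminal[OF _ that] G.preserves_terminal[OF Term_terminal] by simp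
    show "is_product R (on_obj extension A) (on_obj extension B) (on_obj extension Q)
        (on_arr extension p) (on_arr extension q)"
      if "A \<in> Obj (adjoin P X)" "B \<in> Obj (adjoin P X)" "is_product (adjoin P X) A B Q p q"
      for A B Q p q
    proof (rule E.preserves_product[OF that(1,2) _ that(3)])
      have AB: "A \<in> Obj P" "B \<in> Obj P" using that by auto
      show "is_product R (on_obj extension A) (on_obj extension B)
          (on_obj extension (Prod (adjoin P X) A B)) (on_arr extension (Pr1 (adjoin P X) A B))
          (on_arr extension (Pr2 (adjoin P X) A B))"
        using G_product[OF AB] on_arr_extension_Pr2[OF Pr_hom(3,1)[OF AB]]
          on_arr_extension_Pr2[OF Pr_hom(3,2)[OF AB]] by simp
    qed
  next
    fix A assume "A \<in> Obj (adjoin P X)"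
    then have A: "A \<in> Obj P" "Prod P X A \<in> Obj P" using Pr_hom[OF X] by auto
    have carr: "\<And>\<alpha>. \<alpha> \<in> carrier (Fib P (Prod P X A)) \<Longrightarrow>
        on_fib G (Prod P X A) \<alpha> \<in> carrier (Fib R (on_obj G (Prod P X A)))"
      using G.on_fib_carrier[OF A(2)] by blast
    show "on_fib extension A
        \<in> carrier (Fib (adjoin P X) A) \<rightarrow>\<^sub>E carrier (Fib R (on_obj extension A))"
      using R.Reindex_carrier[OF insert_const_hom[OF A(1)]] carr A by (auto simp: extension_def)
    show "isotone (Fib (adjoin P X) A) (Fib R (on_obj extension A)) (on_fib extension A)"
      using G.on_fib_isotone[OF A(2)] R.Reindex_isotone[OF insert_const_hom[OF A(1)]] carr
      by (simp add: isotone_def on_fib_extension[OF A(1)])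
  next
    fix f A B \<alpha> assume "f \<in> hom (adjoin P X) A B" "\<alpha> \<in> carrier (Fib (adjoin P X) B)"
    then obtain f' where A: "A \<in> Obj P" and f: "f = (A, f')" "f' \<in> hom P (Prod P X A) B"
      and \<alpha>: "\<alpha> \<in> carrier (Fib P (Prod P X B))" by (auto simp: hom_adjoin)
    have B: "B \<in> Obj P" using hom_Obj f by blast
    note XB = Pr_hom(3)[OF X B]
    note l = lift[OF A f(2)]
    note s = insert_const_hom[OF A] insert_const_hom[OF B]
    have G\<alpha>: "on_fib G (Prod P X B) \<alpha> \<in> carrier (Fib R (on_obj G (Prod P X B)))"
      using G.on_fib_carrier[OF XB] \<alpha> by blast
    have r\<alpha>: "Reindex P (lift A f') \<alpha> \<in> carrier (Fib P (Prod P X A))"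
      using Reindex_carrier[OF l(1)] \<alpha> by blast
    \<comment> \<open>Both sides reindex \<open>on_fib G (Prod P X B) \<alpha>\<close>, along the
      two arrows that \<open>lift_insert_const\<close> identifies.\<close>
    show "on_fib extension A (Reindex (adjoin P X) f \<alpha>) =
        Reindex R (on_arr extension f) (on_fib extension B \<alpha>)"
      using G.on_fib_natural[OF l(1) \<alpha>] R.Reindex_Comp[OF s(1) G.on_arr_hom[OF l(1)] G\<alpha>]
        R.Reindex_Comp[OF R.Comp_hom[OF s(1) G.on_arr_hom[OF f(2)]] s(2) G\<alpha>]
        lift_insert_const[OF A f(2)] on_fib_extension[OF A r\<alpha>] on_fib_extension[OF B \<alpha>]
        on_arr_extension[OF A f(2)]
      by (simp add: f)
  qed (fact E.hom E.Id E.Comp)+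
qed

text \<open>On arrows and fibres \<open>Pr2 P X A\<close> cancels against
  \<open>insert_const A\<close>; extensionality of the components makes this an equality of
  records.\<close>

lemma extension_adjoin_arrow: "one_comp P extension (adjoin_arrow P X) = G"
proof (rule one_arrow.equality)
  show "on_obj (one_comp P extension (adjoin_arrow P X)) = on_obj G"
    using G.on_obj_Obj
    by (auto simp: one_comp_def on_obj_adjoin_arrow fun_eq_iff PiE_def extensional_def)
  have "on_arr extension (on_arr (adjoin_arrow P X) f) = on_arr G f" if "f \<in> Arr P" for f
  proof -
    have f: "f \<in> hom P (Dom P f) (Cod P f)" using that by (simp add: hom_def)
    then show ?thesis
      using on_arr_extension_Pr2[OF Dom_Obj[OF that] f] on_arr_adjoin_arrow[OF f] by simp
  qed
  then show "on_arr (one_comp P extension (adjoin_arrow P X)) = on_arr G"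
    using G.on_arr_ext by (auto simp: one_comp_def fun_eq_iff extensional_def)
  have "on_fib extension A (on_fib (adjoin_arrow P X) A \<alpha>) = on_fib G A \<alpha>"
    if A: "A \<in> Obj P" and \<alpha>: "\<alpha> \<in> carrier (Fib P A)" for A \<alpha>
  proof -
    note p = Pr_hom(2)[OF X A]
    have "Reindex P (Pr2 P X A) \<alpha> \<in> carrier (Fib P (Prod P X A))"
      using Reindex_carrier[OF p] \<alpha> by blast
    moreover have G\<alpha>: "on_fib G A \<alpha> \<in> carrier (Fib R (on_obj G A))"
      using G.on_fib_carrier[OF A] \<alpha> by blast
    ultimately show ?thesis
      using G.on_fib_natural[OF p \<alpha>] Pr2_insert_const[OF A] R.Reindex_Id[OF G_Obj[OF A] G\<alpha>]
        R.Reindex_Comp[OF insert_const_hom[OF A] G.on_arr_hom[OF p] G\<alpha>]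
      by (simp add: on_fib_extension[OF A] on_fib_adjoin_arrow[OF A \<alpha>])
  qed
  \<comment> \<open>The composite is \<open>undefined\<close> off the carrier by definition, so
    \<open>G\<close> has to be as well.\<close>
  moreover have "on_fib G A \<alpha> = undefined"
    if "A \<in> Obj P" "\<alpha> \<notin> carrier (Fib P A)" for A \<alpha>
    using G.on_fib_carrier[OF that(1)] that(2) by (auto simp: PiE_def extensional_def)
  ultimately show "on_fib (one_comp P extension (adjoin_arrow P X)) = on_fib G"
    using G.on_fib_ext
    by (auto simp: one_comp_def on_obj_adjoin_arrow fun_eq_iff extensional_def)
qed simp

section \<open>The condition on the constant, and uniqueness of the extension\<close>

lemma term_iso:
  assumes "is_terminal R (on_obj H (Term P))"
  shows "term_iso (adjoin P X) R H \<in> hom R (Term R) (on_obj H (Term P))"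
proof -
  have "\<exists>!i. i \<in> hom R (Term R) (on_obj H (Term P))"
    using assms R.Term_terminal unfolding is_terminal_def by (elim conjE bspec)
  from theI'[OF this] show ?thesis by (simp add: term_iso_def)
qed

lemma extension_along_extension: "extension_along P X R G c extension"
  unfolding extension_along_def
proof (intro conjI one_arrow_extension extension_adjoin_arrow)
  have T: "Term P \<in> Obj P" using Term_terminal by (simp add: is_terminal_def)
  let ?i = "term_iso (adjoin P X) R extension"
  have i: "?i \<in> hom R (Term R) (on_obj G (Term P))"
    using term_iso[of extension] G.preserves_terminal[OF Term_terminal] by simp
  \<comment> \<open>Composing with \<open>?i\<close> moves the constant
    \<open>c \<cdot> bang\<close> to the stage \<open>Term R\<close>, where only \<open>c\<close>
    remains.\<close>
  have "bang (Term R) = Id R (Term R)"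
    using R.terminal_eqI[OF R.Term_terminal] bang_hom R.Id_hom R.Term_terminal
    unfolding is_terminal_def by blast
  then show "on_arr extension (adjoin_const P X) \<cdot>\<^bsub>R\<^esub> ?i = c"
    using on_arr_extension[OF T Pr_hom(1)[OF X T]] Pr1_insert_const[OF T] const_bang_Comp[OF i]
      R.Comp_Id[OF c] by (simp add: adjoin_const_def)
qed

text \<open>Restriction to \<open>P\<close> fixes \<open>H\<close> on objects and on everything
  coming from \<open>P\<close>. What remains is the image of one arrow \<open>u A\<close> for each
  \<open>A\<close>, which is determined by its two components.\<close>

lemma extension_unique:
  assumes "extension_along P X R G c H"
  shows "H = extension"
proof -
  interpret S: doctrine "adjoin P X" by (rule doctrine_adjoin)
  interpret H: one_arrow "adjoin P X" R H using assms by (simp add: extension_along_def)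
  have HG: "one_comp P H (adjoin_arrow P X) = G"
    and Hc: "on_arr H (adjoin_const P X) \<cdot>\<^bsub>R\<^esub> term_iso (adjoin P X) R H = c"
    using assms by (auto simp: extension_along_def)
  have obj: "on_obj H A = on_obj G A" if "A \<in> Obj P" for A
    using that by (simp add: HG[symmetric] one_comp_def on_obj_adjoin_arrow)
  have arr: "on_arr H (A, f \<cdot> Pr2 P X A) = on_arr G f" if "f \<in> hom P A B" for f A B
    using that on_arr_adjoin_arrow[OF that]
    by (simp add: HG[symmetric] one_comp_def hom_def)
  have fib: "on_fib H A (Reindex P (Pr2 P X A) \<alpha>) = on_fib G A \<alpha>"
    if "A \<in> Obj P" "\<alpha> \<in> carrier (Fib P A)" for A \<alpha>
    using that by (simp add: HG[symmetric] one_comp_def on_obj_adjoin_arrow on_fib_adjoin_arrow)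
  have T: "Term P \<in> Obj P" using Term_terminal by (simp add: is_terminal_def)
  \<comment> \<open>The condition on the constant is solved for the image of
    \<open>adjoin_const P X\<close>, using that \<open>bang\<close> is inverse to
    \<open>term_iso\<close>.\<close>
  have const: "on_arr H (adjoin_const P X) = c \<cdot>\<^bsub>R\<^esub> bang (on_obj G (Term P))"
  proof -
    let ?i = "term_iso (adjoin P X) R H"
    have GT: "is_terminal R (on_obj G (Term P))" by (rule G.preserves_terminal[OF Term_terminal])
    have i: "?i \<in> hom R (Term R) (on_obj G (Term P))" using term_iso[of H] GT obj[OF T] by simp
    have k: "on_arr H (adjoin_const P X) \<in> hom R (on_obj G (Term P)) (on_obj G X)"
      using H.on_arr_hom[OF adjoin_const_hom] obj T X by simp
    note b = bang_hom[OF G_Obj[OF T]]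
    have "?i \<cdot>\<^bsub>R\<^esub> bang (on_obj G (Term P)) = Id R (on_obj G (Term P))"
      by (rule R.terminal_eqI[OF GT R.Comp_hom[OF b i] R.Id_hom[OF G_Obj[OF T]]])
    then show ?thesis using Hc R.Comp_assoc[OF b i k] R.Comp_Id[OF k] by simp
  qed
  \<comment> \<open>The identity of \<open>Prod P X A\<close>, read as an arrow from
    \<open>A\<close> to \<open>Prod P X A\<close> in the adjoined category.\<close>
  define u where "u A = (A, Id P (Prod P X A))" for A
  have u: "u A \<in> hom (adjoin P X) A (Prod P X A)" if "A \<in> Obj P" for A
    using that Id_hom[OF Pr_hom(3)[OF X that]] by (simp add: u_def hom_adjoin)
  have comp_u: "(Prod P X A, g \<cdot> Pr2 P X (Prod P X A)) \<cdot>\<^bsub>adjoin P X\<^esub> u A = (A, g)"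
    if A: "A \<in> Obj P" and g: "g \<in> hom P (Prod P X A) B" for A g B
    using Comp_Pr2_lift[OF A Id_hom[OF Pr_hom(3)[OF X A]] g] Comp_Id[OF g] by (simp add: u_def)
  have H_comp_u: "on_arr H (A, g) = on_arr G g \<cdot>\<^bsub>R\<^esub> on_arr H (u A)"
    if A: "A \<in> Obj P" and g: "g \<in> hom P (Prod P X A) B" for A g B
    using H.on_arr_Comp[OF u[OF A] adjoin_arrow_hom[OF g]] comp_u[OF A g] arr[OF g]
      on_arr_adjoin_arrow[OF g] by simp
  have Hu: "on_arr H (u A) = insert_const A" if A: "A \<in> Obj P" for A
  proof -
    note XA = Pr_hom[OF X A]
    obtain b where b: "b \<in> hom P (Prod P X A) (Term P)"
      using Term_terminal XA unfolding is_terminal_def by blast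
    have b': "(A, b) \<in> hom (adjoin P X) A (Term P)" using b A by (simp add: hom_adjoin)
    have Hb: "on_arr H (A, b) \<in> hom R (on_obj G A) (on_obj G (Term P))"
      using H.on_arr_hom[OF b'] A T obj by simp
    \<comment> \<open>The first component of \<open>u A\<close> is the generic constant precomposed
      with the arrow to the terminal object, so \<open>H\<close> sends it to the constant
      \<open>c\<close>.\<close>
    have "adjoin_const P X \<cdot>\<^bsub>adjoin P X\<^esub> (A, b) = (A, Pr1 P X A)"
      using lift(2)[OF A b] by (simp add: adjoin_const_def)
    then have Pr1: "on_arr H (A, Pr1 P X A) = c \<cdot>\<^bsub>R\<^esub> bang (on_obj G A)"
      using H.on_arr_Comp[OF b', of "adjoin_const P X" X] adjoin_const_hom const
        const_bang_Comp[OF Hb] by simp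
    have Pr2: "on_arr H (A, Pr2 P X A) = Id R (on_obj G A)"
      using H.on_arr_Id[of A] A obj by simp
    have "on_arr H (u A) = insert_const A \<cdot>\<^bsub>R\<^esub> Id R (on_obj G A)"
    proof (rule insert_const_eqI[OF A])
      show "on_arr H (u A) \<in> hom R (on_obj G A) (on_obj G (Prod P X A))"
        using H.on_arr_hom[OF u[OF A]] obj A XA by simp
    qed (use R.Id_hom[OF G_Obj[OF A]] H_comp_u[OF A] XA Pr1 Pr2 in auto)
    then show ?thesis using R.Comp_Id[OF insert_const_hom[OF A]] by simp
  qed
  show ?thesis
  proof (rule one_arrow.equality)
    show "on_obj H = on_obj extension"
      using H.on_obj_Obj G.on_obj_Obj obj
      by (auto simp: PiE_def intro: extensionalityI)
    have "on_arr H x = on_arr extension x" if "x \<in> Arr (adjoin P X)" for x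
    proof -
      have "x \<in> hom (adjoin P X) (Dom (adjoin P X) x) (Cod (adjoin P X) x)"
        using that by (simp add: hom_def)
      then obtain A g where "A \<in> Obj P" "x = (A, g)" "g \<in> hom P (Prod P X A) (Cod (adjoin P X) x)"
        by (auto simp only: hom_adjoin)
      then show ?thesis using H_comp_u Hu on_arr_extension by simp
    qed
    then show "on_arr H = on_arr extension"
      using H.on_arr_ext one_arrow.on_arr_ext[OF one_arrow_extension]
      by (auto intro: extensionalityI)
    have "on_fib H A \<alpha> = on_fib extension A \<alpha>"
      if A: "A \<in> Obj P" and \<alpha>: "\<alpha> \<in> carrier (Fib P (Prod P X A))" for A \<alpha>
    proof -
      note XA = Pr_hom(3)[OF X A]
      note p = Pr_hom(2)[OF X XA]
      \<comment> \<open>\<open>?\<beta>\<close> comes from \<open>P\<close>, where \<open>H\<close>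
        agrees with \<open>G\<close>, and reindexing it along \<open>u A\<close> returns
        \<open>\<alpha>\<close>; naturality of \<open>H\<close> at \<open>u A\<close> then fixes the
        value at \<open>\<alpha>\<close>.\<close>
      let ?\<beta> = "Reindex P (Pr2 P X (Prod P X A)) \<alpha>"
      have \<beta>: "?\<beta> \<in> carrier (Fib (adjoin P X) (Prod P X A))"
        using Reindex_carrier[OF p] \<alpha> by auto
      have "Reindex (adjoin P X) (u A) ?\<beta> = \<alpha>"
        using Reindex_Comp[OF lift(1)[OF A Id_hom[OF XA]] p \<alpha>] lift(3)[OF A Id_hom[OF XA]]
          Reindex_Id[OF XA \<alpha>] by (simp add: u_def)
      then show ?thesis
        using H.on_fib_natural[OF u[OF A] \<beta>] fib[OF XA \<alpha>] Hu[OF A] on_fib_extension[OF A \<alpha>]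
        by simp
    qed
    then have "on_fib H A = on_fib extension A" if "A \<in> Obj P" for A
      using H.on_fib_carrier[of A] one_arrow.on_fib_carrier[OF one_arrow_extension, of A] that
      by (auto simp: PiE_def intro: extensionalityI)
    then show "on_fib H = on_fib extension"
      using H.on_fib_ext one_arrow.on_fib_ext[OF one_arrow_extension]
      by (auto intro: extensionalityI)
  qed simp
qed

section \<open>Invertible 2-cells between extensions\<close>

lemma invertible_id_cell_extension:
  "invertible_two_cell (adjoin P X) R extension extension (id_cell (adjoin P X) R extension)"
proof -
  interpret H: one_arrow "adjoin P X" R extension by (rule one_arrow_extension)
  have "two_cell (adjoin P X) R extension extension (id_cell (adjoin P X) R extension)"
    unfolding two_cell_def
  proof (intro conjI ballI)
    fix A \<alpha> assume A: "A \<in> Obj (adjoin P X)" and \<alpha>: "\<alpha> \<in> carrier (Fib (adjoin P X) A)"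
    have *: "on_fib extension A \<alpha> \<in> carrier (Fib R (on_obj extension A))"
      using H.on_fib_carrier[OF A] \<alpha> by blast
    have GA: "on_obj extension A \<in> Obj R" using A G_Obj by simp
    interpret po: partial_order "Fib R (on_obj extension A)" by (rule R.Fib_poset[OF GA])
    show "on_fib extension A \<alpha> \<sqsubseteq>\<^bsub>Fib R (on_obj extension A)\<^esub>
        Reindex R (id_cell (adjoin P X) R extension A) (on_fib extension A \<alpha>)"
      using A R.Reindex_Id[OF GA *] po.le_refl[OF *] by (simp add: id_cell_def)
  next
    fix A B f
    assume "A \<in> Obj (adjoin P X)" "B \<in> Obj (adjoin P X)" "f \<in> hom (adjoin P X) A B"
    then show "id_cell (adjoin P X) R extension B \<cdot>\<^bsub>R\<^esub> on_arr extension f =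
        on_arr extension f \<cdot>\<^bsub>R\<^esub> id_cell (adjoin P X) R extension A"
      using R.Id_Comp[OF H.on_arr_hom] R.Comp_Id[OF H.on_arr_hom] by (simp add: id_cell_def)
  qed (use R.Id_hom G_Obj in \<open>auto simp: id_cell_def\<close>)
  moreover have "vcomp (adjoin P X) R (id_cell (adjoin P X) R extension)
      (id_cell (adjoin P X) R extension) = id_cell (adjoin P X) R extension"
    using R.Comp_Id[OF R.Id_hom] G_Obj
    by (auto simp: vcomp_def id_cell_def fun_eq_iff restrict_def)
  ultimately show ?thesis unfolding invertible_two_cell_def by blast
qed

text \<open>The canonical 1-arrow is the identity on objects, so whiskering with it returns the
  2-cell itself; the whiskering condition alone forces the identity cell.\<close>

lemma ex1_invertible_two_cell:
  "\<exists>!\<theta>. invertible_two_cell (adjoin P X) R extension extension \<theta> \<and>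
     whisker P \<theta> (adjoin_arrow P X) = id_cell P R G"
proof (rule ex1I)
  show "invertible_two_cell (adjoin P X) R extension extension
      (id_cell (adjoin P X) R extension) \<and>
    whisker P (id_cell (adjoin P X) R extension) (adjoin_arrow P X) = id_cell P R G"
    using invertible_id_cell_extension
    by (auto simp: whisker_def id_cell_def on_obj_adjoin_arrow fun_eq_iff)
  fix \<theta>
  assume *: "invertible_two_cell (adjoin P X) R extension extension \<theta> \<and>
     whisker P \<theta> (adjoin_arrow P X) = id_cell P R G"
  then have "\<theta> \<in> extensional (Obj P)" by (simp add: invertible_two_cell_def two_cell_def)
  then have "\<theta> = whisker P \<theta> (adjoin_arrow P X)"
    by (auto simp: whisker_def on_obj_adjoin_arrow fun_eq_iff extensional_def)
  then show "\<theta> = id_cell (adjoin P X) R extension" using * by (simp add: id_cell_def)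
qed

end

theorem corollary6p7:
  fixes P :: "('o, 'a, 'p) doctrine" and X :: 'o
  assumes "doctrine P" and "X \<in> Obj P"
  shows "doctrine (adjoin P X) \<and>
    one_arrow P (adjoin P X) (adjoin_arrow P X) \<and>
    adjoin_const P X \<in> hom (adjoin P X) (Term (adjoin P X)) X \<and>
    (\<forall>(R :: ('d, 'b, 'q) doctrine) G c.
       doctrine R \<longrightarrow> one_arrow P R G \<longrightarrow> c \<in> hom R (Term R) (on_obj G X) \<longrightarrow>
       (\<exists>H. extension_along P X R G c H) \<and>
       (\<forall>H H'. extension_along P X R G c H \<longrightarrow> extension_along P X R G c H' \<longrightarrow>
          (\<exists>!\<theta>. invertible_two_cell (adjoin P X) R H H' \<theta> \<and>
                whisker P \<theta> (adjoin_arrow P X) = id_cell P R G)))"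
proof -
  interpret adjoined_constant P X
    using assms by (simp add: adjoined_constant_def adjoined_constant_axioms_def)
  show ?thesis
  proof (intro conjI allI impI doctrine_adjoin one_arrow_adjoin_arrow adjoin_const_hom)
    fix R :: "('d, 'b, 'q) doctrine" and G c
    assume "doctrine R" "one_arrow P R G" "c \<in> hom R (Term R) (on_obj G X)"
    then interpret extension_problem P X R G c
      by (intro extension_problem.intro extension_problem_axioms.intro adjoined_constant_axioms)
    show "\<exists>H. extension_along P X R G c H" using extension_along_extension by blast
    fix H H' assume "extension_along P X R G c H" "extension_along P X R G c H'"
    \<comment> \<open>Both 1-arrows coincide with \<open>extension\<close>, so only 2-cells from it
      to itself remain.\<close>
    then have "H = extension" "H' = extension" using extension_unique by blast+
    then show "\<exists>!\<theta>. invertible_two_cell (adjoin P X) R H H' \<theta> \<and>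
        whisker P \<theta> (adjoin_arrow P X) = id_cell P R G"
      using ex1_invertible_two_cell by blast
  qed
qed

end
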